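(* Let $n\ge 1$, let $A\in\mathbb{R}^{n\times n}$ and $B\in\mathbb{R}^{1\times n}$, and suppose that the matrix $M=\begin{bmatrix}A & B^T\\ B & 0\end{bmatrix}\in\mathbb{R}^{(n+1)\times(n+1)}$ is invertible (so in particular $B\neq 0$). Let $Z=Z(B)\in\mathbb{R}^{n\times(n-1)}$ be the matrix constructed from $B$ as described in the context. Then $$|Z^TAZ|\le 4|A|,$$ where $|\cdot|$ denotes the number of nonzero entries of a matrix.
   Context: For a matrix or vector $X$, $|X|$ denotes the number of nonzero entries of $X$. Construction of $Z(B)$. Let $B=\begin{bmatrix} b_1&b_2&\cdots&b_n\end{bmatrix}\in\mathbb{R}^{1\times n}$ have at least one nonzero entry, and let $p$ be the largest index with $b_p\ne 0$. Let $e_1,\dots,e_n$ be the standard basis of $\mathbb{R}^n$. The matrix $Z(B)\in\mathbb{R}^{n\times(n-1)}$ has columns $z_1,\dots,z_{n-1}$ given by: (i) if $k<p$ and $b_k=0$, then $z_k=e_k$; (ii) if $k<p$ and $b_k\neq 0$, then $z_k=e_k-\frac{b_k}{b_j}e_j$, where $j$ is the smallest index with $j>k$ and $b_j\ne 0$; (iii) if $p\le k\le n-1$, then $z_k=e_{k+1}$. *)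

theory Defs
  imports Complex_Main "Jordan_Normal_Form.Matrix"
begin

definition nnz :: "'a :: zero mat \<Rightarrow> nat" where
  "nnz X = card {(i, j). i < dim_row X \<and> j < dim_col X \<and> X $$ (i, j) \<noteq> 0}"

text \<open>
  Rows, columns and unit vectors are indexed from 0, so the k-th index of the usual 1-based
  description is k - 1 here. The definitions below are meaningful only for a nonzero row matrix.
\<close>

definition last_nz :: "real mat \<Rightarrow> nat" where
  "last_nz B = Max {k. k < dim_col B \<and> B $$ (0, k) \<noteq> 0}"

definition next_nz :: "real mat \<Rightarrow> nat \<Rightarrow> nat" where
  "next_nz B k = (LEAST j. k < j \<and> j < dim_col B \<and> B $$ (0, j) \<noteq> 0)"

definition Z_col :: "real mat \<Rightarrow> nat \<Rightarrow> real vec" where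
  "Z_col B k =
     (if k < last_nz B then
        (if B $$ (0, k) = 0 then unit_vec (dim_col B) k
         else unit_vec (dim_col B) k
              - (B $$ (0, k) / B $$ (0, next_nz B k)) \<cdot>\<^sub>v unit_vec (dim_col B) (next_nz B k))
      else unit_vec (dim_col B) (k + 1))"

definition Z_mat :: "real mat \<Rightarrow> real mat" where
  "Z_mat B = mat_of_cols (dim_col B) (map (Z_col B) [0..<dim_col B - 1])"

end

theory Submission
  imports Defs
begin

text \<open>
  The bound is purely combinatorial: it follows from the fact that every row of \<open>Z(B)\<close> has at most
  two nonzero entries. An entry \<open>(k, l)\<close> of \<open>Z\<^sup>T A Z\<close> is the sum of the
  terms \<open>Z\<^sub>i\<^sub>k A\<^sub>i\<^sub>j Z\<^sub>j\<^sub>l\<close>, so if it is nonzero it is caused by some nonzero entry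
  \<open>(i, j)\<close> of \<open>A\<close> for which \<open>k\<close> lies in the support of row \<open>i\<close> of \<open>Z\<close> and \<open>l\<close> in the support of
  row \<open>j\<close>. Hence each nonzero entry of \<open>A\<close> causes at most \<open>2 \<cdot> 2\<close> nonzero entries of the
  product (\<open>nnz_transpose_mult_mult_le\<close>).

  Row \<open>i\<close> of \<open>Z(B)\<close> is nonzero in column \<open>i\<close> possibly, and in a column \<open>k \<noteq> i\<close> only if \<open>k\<close> is a
  predecessor of \<open>i\<close>: either \<open>b\<^sub>k\<close> and \<open>b\<^sub>i\<close> are consecutive nonzero entries of \<open>B\<close>, so that \<open>i\<close> is
  not beyond the last nonzero position \<open>p\<close>, or \<open>k + 1 = i\<close> and \<open>i\<close> is beyond \<open>p\<close>. The predecessor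
  of \<open>i\<close> is unique (\<open>Z_mat_row_support_le_2\<close>).
\<close>

definition row_support :: "'a :: zero mat \<Rightarrow> nat \<Rightarrow> nat set" where
  "row_support X i = {k. k < dim_col X \<and> X $$ (i, k) \<noteq> 0}"

lemma finite_row_support [simp]: "finite (row_support X i)"
  by (simp add: row_support_def)

lemma mult_mat_nonzeroE:
  fixes X Y :: "'a :: semiring_0 mat"
  assumes "(X * Y) $$ (k, l) \<noteq> 0" "k < dim_row X" "l < dim_col Y" "dim_col X = dim_row Y"
  obtains j where "j < dim_row Y" "X $$ (k, j) \<noteq> 0" "Y $$ (j, l) \<noteq> 0"
proof -
  have "(\<Sum>j\<in>{0..<dim_row Y}. X $$ (k, j) * Y $$ (j, l)) \<noteq> 0"
    using assms by (simp add: scalar_prod_def)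
  then obtain j where "j \<in> {0..<dim_row Y}" "X $$ (k, j) * Y $$ (j, l) \<noteq> 0"
    by (rule sum.not_neutral_contains_not_neutral)
  then show thesis
    using that[of j] by (metis atLeastLessThan_iff mult_zero_left mult_zero_right)
qed

text \<open>
  The support of \<open>P\<^sup>T A Q\<close> is covered by the rectangles \<open>row_support P i \<times> row_support Q j\<close>, one for
  each nonzero entry \<open>(i, j)\<close> of \<open>A\<close>; cancellation in the product can only make it smaller.
\<close>

lemma nnz_transpose_mult_mult_le:
  fixes A P Q :: "'a :: semiring_0 mat"
  assumes dims: "dim_row P = dim_row A" "dim_row Q = dim_col A"
    and P: "\<And>i. i < dim_row A \<Longrightarrow> card (row_support P i) \<le> r"
    and Q: "\<And>j. j < dim_col A \<Longrightarrow> card (row_support Q j) \<le> s"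
  shows "nnz (transpose_mat P * A * Q) \<le> r * s * nnz A"
proof -
  define S where "S = {(i, j). i < dim_row A \<and> j < dim_col A \<and> A $$ (i, j) \<noteq> 0}"
  define T where "T = (\<lambda>(i, j). row_support P i \<times> row_support Q j)"
  have "finite S"
    by (rule finite_subset[of _ "{..<dim_row A} \<times> {..<dim_col A}"]) (auto simp: S_def)
  have "{(k, l). k < dim_row (transpose_mat P * A * Q) \<and> l < dim_col (transpose_mat P * A * Q)
          \<and> (transpose_mat P * A * Q) $$ (k, l) \<noteq> 0} \<subseteq> (\<Union>x\<in>S. T x)"
  proof clarify
    fix k l
    assume "k < dim_row (transpose_mat P * A * Q)" "l < dim_col (transpose_mat P * A * Q)"
      and nz: "(transpose_mat P * A * Q) $$ (k, l) \<noteq> 0"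
    then have k: "k < dim_col P" and l: "l < dim_col Q"
      by auto
    obtain j where j: "j < dim_col A" "(transpose_mat P * A) $$ (k, j) \<noteq> 0" "Q $$ (j, l) \<noteq> 0"
      using mult_mat_nonzeroE[OF nz] k l dims by auto
    obtain i where i: "i < dim_row A" "transpose_mat P $$ (k, i) \<noteq> 0" "A $$ (i, j) \<noteq> 0"
      using mult_mat_nonzeroE[OF j(2)] j(1) k dims by auto
    have "(i, j) \<in> S" "(k, l) \<in> T (i, j)"
      using i j k l dims by (auto simp: S_def T_def row_support_def)
    then show "(k, l) \<in> (\<Union>x\<in>S. T x)"
      by blast
  qed
  moreover have "finite (\<Union>x\<in>S. T x)"
    using \<open>finite S\<close> by (auto simp: T_def)
  ultimately have "nnz (transpose_mat P * A * Q) \<le> card (\<Union>x\<in>S. T x)"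
    unfolding nnz_def by (rule card_mono[rotated])
  also have "\<dots> \<le> (\<Sum>x\<in>S. card (T x))"
    by (rule card_UN_le[OF \<open>finite S\<close>])
  also have "\<dots> \<le> (\<Sum>x\<in>S. r * s)"
    by (intro sum_mono) (auto simp: S_def T_def card_cartesian_product intro!: mult_le_mono P Q)
  also have "\<dots> = r * s * nnz A"
    by (simp add: S_def nnz_def mult.commute)
  finally show ?thesis .
qed

lemma last_nz_nonzero:
  assumes "k < dim_col B" "B $$ (0, k) \<noteq> 0"
  shows "last_nz B < dim_col B" "B $$ (0, last_nz B) \<noteq> 0"
proof -
  have "last_nz B \<in> {k. k < dim_col B \<and> B $$ (0, k) \<noteq> 0}"
    unfolding last_nz_def using assms by (intro Max_in) auto
  then show "last_nz B < dim_col B" "B $$ (0, last_nz B) \<noteq> 0"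
    by auto
qed

lemma next_nz_le:
  assumes "k < j" "j < dim_col B" "B $$ (0, j) \<noteq> 0"
  shows "next_nz B k \<le> j"
  unfolding next_nz_def using assms by (intro Least_le) auto

lemma next_nz_greater:
  assumes "k < last_nz B" "k < dim_col B" "B $$ (0, k) \<noteq> 0"
  shows "k < next_nz B k"
proof -
  have "k < next_nz B k \<and> next_nz B k < dim_col B \<and> B $$ (0, next_nz B k) \<noteq> 0"
    unfolding next_nz_def
    by (rule LeastI[of _ "last_nz B"]) (use assms last_nz_nonzero in auto)
  then show ?thesis
    by simp
qed

lemma next_nz_inject:
  assumes "k < last_nz B" "k < dim_col B" "B $$ (0, k) \<noteq> 0"
    and "k' < last_nz B" "k' < dim_col B" "B $$ (0, k') \<noteq> 0"
    and "next_nz B k = next_nz B k'"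
  shows "k = k'"
proof (rule linorder_cases[of k k'])
  assume "k < k'"
  then show ?thesis
    using next_nz_le[of k k' B] next_nz_greater[of k' B] assms by simp
next
  assume "k' < k"
  then show ?thesis
    using next_nz_le[of k' k B] next_nz_greater[of k B] assms by simp
qed

lemma dim_Z_mat [simp]: "dim_row (Z_mat B) = dim_col B" "dim_col (Z_mat B) = dim_col B - 1"
  by (simp_all add: Z_mat_def)

lemma Z_mat_off_diagonal_nonzeroD:
  assumes "i < dim_col B" "k < dim_col B - 1" "Z_mat B $$ (i, k) \<noteq> 0" "k \<noteq> i"
  shows "k < last_nz B \<and> B $$ (0, k) \<noteq> 0 \<and> next_nz B k = i \<or> last_nz B \<le> k \<and> k + 1 = i"
proof -
  have "Z_mat B $$ (i, k) = Z_col B k $ i"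
    using assms by (simp add: Z_mat_def mat_of_cols_index)
  then show ?thesis
    using assms by (auto simp: Z_col_def unit_vec_def split: if_splits)
qed

text \<open>
  Off the diagonal, a nonzero entry of row \<open>i\<close> comes either from the successor map \<open>next_nz B\<close>,
  which is injective on the nonzero positions before the last one and takes no value beyond the
  last one, or from the shift \<open>k \<mapsto> k + 1\<close> on the positions \<open>k \<ge> last_nz B\<close>, whose values are all
  beyond the last one. So at most one off-diagonal entry of the row is nonzero.
\<close>

lemma Z_mat_row_support_le_2:
  assumes i: "i < dim_col B"
  shows "card (row_support (Z_mat B) i) \<le> 2"
proof -
  define R where "R = row_support (Z_mat B) i - {i}"
  have "k = k'" if "k \<in> R" "k' \<in> R" for k k'
  proof -
    have k: "k < dim_col B" "k' < dim_col B"
      using that by (auto simp: R_def row_support_def)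
    have cases: "m < last_nz B \<and> B $$ (0, m) \<noteq> 0 \<and> next_nz B m = i \<or> last_nz B \<le> m \<and> m + 1 = i"
      if "m \<in> R" for m
      using that Z_mat_off_diagonal_nonzeroD[OF i, of m] by (auto simp: R_def row_support_def)
    have not_beyond: "next_nz B m \<le> last_nz B"
      if "m < last_nz B" "m < dim_col B" "B $$ (0, m) \<noteq> 0" for m
      using next_nz_le[OF that(1) last_nz_nonzero[OF that(2,3)]] .
    from cases[OF \<open>k \<in> R\<close>] cases[OF \<open>k' \<in> R\<close>] show ?thesis
    proof (elim disjE conjE)
      assume "k < last_nz B" "B $$ (0, k) \<noteq> 0" "next_nz B k = i"
        "k' < last_nz B" "B $$ (0, k') \<noteq> 0" "next_nz B k' = i"
      then show ?thesis
        using next_nz_inject[of k B k'] k by simp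
    next
      assume "k < last_nz B" "B $$ (0, k) \<noteq> 0" "next_nz B k = i" "last_nz B \<le> k'" "k' + 1 = i"
      then show ?thesis
        using not_beyond[of k] k by linarith
    next
      assume "last_nz B \<le> k" "k + 1 = i" "k' < last_nz B" "B $$ (0, k') \<noteq> 0" "next_nz B k' = i"
      then show ?thesis
        using not_beyond[of k'] k by linarith
    qed simp
  qed
  moreover have "finite R"
    by (simp add: R_def)
  ultimately have "card R \<le> 1"
    by (simp add: card_le_Suc0_iff_eq)
  moreover have "card (row_support (Z_mat B) i) \<le> card (insert i R)"
    by (rule card_mono) (auto simp: R_def)
  ultimately show ?thesis
    using card_insert_le_m1[of 2 R i] by simp
qed

theorem theorem4p4:
  fixes n :: nat and A B :: "real mat"
  assumes "n \<ge> 1"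
    and "A \<in> carrier_mat n n"
    and "B \<in> carrier_mat 1 n"
    and "invertible_mat (four_block_mat A (transpose_mat B) B (0\<^sub>m 1 1))"
  shows "nnz (transpose_mat (Z_mat B) * A * Z_mat B) \<le> 4 * nnz A"
proof -
  have "nnz (transpose_mat (Z_mat B) * A * Z_mat B) \<le> 2 * 2 * nnz A"
    using assms(2,3) by (intro nnz_transpose_mult_mult_le Z_mat_row_support_le_2) auto
  then show ?thesis
    by simp
qed

end
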